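(* Let $p$ be an odd prime, $e\ge1$, $q=p^{2e}$, and let $n$ be a positive integer. Let $M(n,0,0)$ denote the number of $n$-element subsets $\{x_1,\dots,x_n\}$ of $\mathbb{F}_q$ satisfying $$x_1^2+\cdots+x_n^2=0,\qquad x_1+\cdots+x_n=0.$$ (i) If $p\nmid n$, then $$M(n,0,0)=\frac{1}{q^2}\binom{q}{n}+\frac{q-1}{2\sqrt{q^3}}\big(\alpha(n)-(-1)^n\beta(n)\big).$$ (ii) If $p\mid n$, then $$M(n,0,0)=\frac{1}{q^2}\binom{q}{n}+\frac{q-1}{q^2}\binom{q/p}{n/p}+\frac{q-1}{2q}\big(\alpha(n)+(-1)^n\beta(n)\big).$$
   Context: Here $\sqrt{q}=p^e$, and for an integer $m\ge0$, $$\alpha(m)=\sum_{\substack{i+pj=m\\ 0\le i\le\sqrt{q},\ j\ge 0}}\binom{\sqrt{q}}{i}\binom{\frac{q-\sqrt{q}}{p}}{j},\qquad \beta(m)=\sum_{\substack{i+pj=m\\ i\ge 0,\ j\ge 0}}(-1)^j\binom{\sqrt{q}-1+i}{\sqrt{q}-1}\binom{\frac{q+\sqrt{q}}{p}}{j}.$$ *)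

theory Defs
  imports Complex_Main "HOL-Library.Cardinality" "HOL-Computational_Algebra.Primes"
begin

definition M :: "nat \<Rightarrow> 'a :: {field, finite} \<Rightarrow> 'a \<Rightarrow> nat" where
  "M n a b = card {S :: 'a set. card S = n \<and> (\<Sum>x\<in>S. x ^ 2) = a \<and> (\<Sum>x\<in>S. x) = b}"

text \<open>In alpha and beta below, with parameters p and e, we have q = p ^ (2 * e), so that the
  square root of q is p ^ e. For a prime p and positive e the index sets are finite and the natural
  number divisions by p are exact.\<close>

definition alpha :: "nat \<Rightarrow> nat \<Rightarrow> nat \<Rightarrow> nat" where
  "alpha p e m =
     (\<Sum>(i, j) \<in> {(i, j). i + p * j = m \<and> i \<le> p ^ e}.
        (p ^ e choose i) * ((p ^ (2 * e) - p ^ e) div p choose j))"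

definition beta :: "nat \<Rightarrow> nat \<Rightarrow> nat \<Rightarrow> int" where
  "beta p e m =
     (\<Sum>(i, j) \<in> {(i, j). i + p * j = m}.
        (- 1) ^ j * int (p ^ e - 1 + i choose (p ^ e - 1))
          * int ((p ^ (2 * e) + p ^ e) div p choose j))"

end

theory Submission
  imports
    Defs
    "HOL-Computational_Algebra.Formal_Power_Series"
    "HOL-Computational_Algebra.Polynomial"
    "HOL-Number_Theory.Cong"
begin

text \<open>
  Fix a nontrivial additive character \<open>\<psi>\<close> of the field. Detecting the two conditions by orthogonality,
  \<open>q\<^sup>2 M(n,0,0)\<close> is the sum over all pairs \<open>(a, b)\<close> of the \<open>n\<close>-th elementary symmetric polynomial of the
  values \<open>\<psi> (a x\<^sup>2 + b x)\<close>. Completing the square reduces the case of nonzero \<open>a\<close> to \<open>b = 0\<close>.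
  The power sums of the \<open>\<psi> (a x\<^sup>2)\<close> are quadratic Gauss sums. As \<open>q\<close> is an even power of \<open>p\<close>, all
  elements of the prime field are squares, so the Gauss sum \<open>g\<close> is unchanged when \<open>a\<close> is scaled by a
  nonzero element of the prime field. The scalar \<open>-1\<close> turns the classical \<open>g(a) g(-a) = q\<close> into
  \<open>g = \<plusminus>p\<^sup>e\<close>, and the other scalars show that the power sums are \<open>g\<close>, or \<open>q\<close> when the exponent is divisible by \<open>p\<close>, which forces
  \<open>\<Prod>(1 + \<psi> (a x\<^sup>2) t) = (1 + t)\<^sup>g (1 + t\<^sup>p)\<^bsup>(q - g) / p\<^esup>\<close>.
  The coefficients of this series are \<open>\<alpha>(n)\<close> or \<open>(-1)\<^sup>n \<beta>(n)\<close> according to the sign of \<open>g\<close>, and both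
  signs occur equally often because the Gauss sums over nonzero \<open>a\<close> add up to zero.
\<close>

subsection \<open>Elementary symmetric functions and power sums\<close>

unbundle fps_syntax

text \<open>Indexing by subsets of the type counts equal values at different points separately, as a
  count of subsets of the field requires.\<close>

definition elem_sym :: "('a :: finite \<Rightarrow> 'b :: comm_semiring_1) \<Rightarrow> nat \<Rightarrow> 'b" where
  "elem_sym f n = (\<Sum>S | card S = n. \<Prod>x\<in>S. f x)"

lemma elem_sym_scale: "elem_sym (\<lambda>x. c * f x) n = c ^ n * elem_sym f n"
  unfolding elem_sym_def sum_distrib_left
  by (intro sum.cong) (auto simp: prod.distrib)

lemma elem_sym_bij:
  fixes h :: "'a :: finite \<Rightarrow> 'a"
  assumes "bij h"
  shows "elem_sym (\<lambda>x. f (h x)) n = elem_sym f n"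
proof -
  have inj: "inj h" and surj: "surj h"
    using assms by (auto simp: bij_def)
  show ?thesis
    unfolding elem_sym_def
  proof (rule sum.reindex_bij_witness[of _ "\<lambda>S. h -` S" "\<lambda>S. h ` S"])
    fix S assume S: "S \<in> {S :: 'a set. card S = n}"
    show "h -` h ` S = S" "h ` S \<in> {S. card S = n}"
      using S inj by (auto simp: card_image inj_on_subset inj_vimage_image_eq)
    show "prod f (h ` S) = (\<Prod>x\<in>S. f (h x))"
      using inj by (simp add: prod.reindex inj_on_subset)
    show "h ` (h -` S) = S"
      using surj by (simp add: surj_image_vimage_eq)
    show "h -` S \<in> {S. card S = n}"
      using S assms by (auto simp: card_vimage_inj inj surj)
  qed
qed

lemma elem_sym_eq_fps_nth:
  fixes f :: "'a :: finite \<Rightarrow> 'b :: comm_ring_1"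
  shows "elem_sym f n = (\<Prod>x\<in>UNIV. 1 + fps_const (f x) * fps_X) $ n"
proof -
  have const_prod: "(\<Prod>x\<in>S. fps_const (f x)) = fps_const (\<Prod>x\<in>S. f x)" for S
    by (induction S rule: infinite_finite_induct) auto
  have "(\<Prod>x\<in>UNIV. 1 + fps_const (f x) * fps_X) = (\<Sum>S\<in>UNIV. \<Prod>x\<in>S. fps_const (f x) * fps_X)"
    by (subst add.commute, subst prod_add) auto
  also have "\<dots> = (\<Sum>S\<in>UNIV. fps_const (\<Prod>x\<in>S. f x) * fps_X ^ card S)"
    by (simp add: prod.distrib const_prod)
  also have "\<dots> $ n = (\<Sum>S\<in>UNIV. if card S = n then \<Prod>x\<in>S. f x else 0)"
    unfolding fps_sum_nth by (intro sum.cong) (auto simp: fps_X_power_nth)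
  also have "\<dots> = elem_sym f n"
    by (simp add: elem_sym_def sum.If_cases)
  finally show ?thesis ..
qed

text \<open>The coefficient of \<open>t ^ m\<close> in the equation expresses
  \<open>(m + 1) * F $ (m + 1)\<close> through \<open>F $ 0\<close>, ..., \<open>F $ m\<close>;
  characteristic zero allows division by \<open>m + 1\<close>.\<close>

lemma fps_linear_ode_unique:
  fixes F G D :: "'a :: field_char_0 fps"
  assumes F: "fps_deriv F = D * F" and G: "fps_deriv G = D * G" and "F $ 0 = G $ 0"
  shows "F = G"
proof (rule fps_ext)
  fix n show "F $ n = G $ n"
  proof (induction n rule: less_induct)
    case (less n)
    show ?case
    proof (cases n)
      case (Suc m)
      have "of_nat n * F $ n = (D * F) $ m" "of_nat n * G $ n = (D * G) $ m"
        unfolding F[symmetric] G[symmetric] by (simp_all add: Suc)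
      moreover have "(D * F) $ m = (D * G) $ m"
        unfolding fps_mult_nth using less Suc by (intro sum.cong) auto
      ultimately have "of_nat n * F $ n = of_nat n * G $ n"
        by simp
      thus ?thesis
        using Suc by (metis mult_cancel_left of_nat_eq_0_iff nat.distinct(1))
    qed (use assms in simp)
  qed
qed

text \<open>Newton's identities: the logarithmic derivative of \<open>\<Prod>(1 + f x t)\<close> generates the power sums.\<close>
lemma fps_deriv_prod_linear:
  fixes f :: "'a \<Rightarrow> 'b :: field"
  assumes "finite A"
  shows "fps_deriv (\<Prod>x\<in>A. 1 + fps_const (f x) * fps_X) =
           Abs_fps (\<lambda>k. (-1) ^ k * (\<Sum>x\<in>A. f x ^ Suc k)) * (\<Prod>x\<in>A. 1 + fps_const (f x) * fps_X)"
  using assms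
proof (induction A rule: finite_induct)
  case (insert a A)
  \<comment> \<open>\<open>L\<close> is the geometric series of \<open>f a / (1 + f a * t)\<close>,
    the logarithmic derivative of the new factor.\<close>
  define L where "L = Abs_fps (\<lambda>k. (-1) ^ k * f a ^ Suc k)"
  have L: "L * (1 + fps_const (f a) * fps_X) = fps_const (f a)"
  proof (rule fps_ext)
    fix n
    have "L * (1 + fps_const (f a) * fps_X) = L + fps_const (f a) * (fps_X * L)"
      by (simp add: distrib_left mult_ac)
    thus "(L * (1 + fps_const (f a) * fps_X)) $ n = fps_const (f a) $ n"
      by (cases n) (simp_all add: L_def)
  qed
  define P where "P = (\<Prod>x\<in>A. 1 + fps_const (f x) * fps_X)"
  define D where "D = Abs_fps (\<lambda>k. (-1) ^ k * (\<Sum>x\<in>A. f x ^ Suc k))"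
  have IH: "fps_deriv P = D * P"
    using insert.IH by (simp add: P_def D_def)
  have *: "Abs_fps (\<lambda>k. (-1) ^ k * (\<Sum>x\<in>insert a A. f x ^ Suc k)) = L + D"
    by (rule fps_ext) (use insert in \<open>simp add: L_def D_def algebra_simps\<close>)
  have "fps_deriv ((1 + fps_const (f a) * fps_X) * P) = (L + D) * ((1 + fps_const (f a) * fps_X) * P)"
  proof -
    have "fps_deriv ((1 + fps_const (f a) * fps_X) * P)
        = fps_const (f a) * P + (1 + fps_const (f a) * fps_X) * (D * P)"
      by (simp add: IH add.commute)
    also have "fps_const (f a) * P = L * (1 + fps_const (f a) * fps_X) * P"
      by (simp only: L)
    also have "\<dots> + (1 + fps_const (f a) * fps_X) * (D * P) = (L + D) * ((1 + fps_const (f a) * fps_X) * P)"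
      by (simp add: algebra_simps)
    finally show ?thesis .
  qed
  thus ?case
    using insert * by (simp add: P_def)
qed (auto simp: fps_eq_iff)

text \<open>The factors have logarithmic derivatives \<open>r / (1 + t)\<close> and
  \<open>p * s * t ^ (p - 1) / (1 + t ^ p)\<close>. Because \<open>p\<close> is odd, every nonzero
  term of either expansion carries the sign \<open>(-1) ^ k\<close> at \<open>t ^ k\<close>.\<close>

lemma fps_deriv_binomial_power:
  fixes r :: "'a :: field_char_0"
  assumes "odd p"
  shows "fps_deriv (fps_binomial r * (1 + fps_X ^ p) ^ s) =
           Abs_fps (\<lambda>k. (-1) ^ k * (r + (if p dvd Suc k then of_nat (p * s) else 0)))
             * (fps_binomial r * (1 + fps_X ^ p) ^ s)"
proof -
  \<comment> \<open>\<open>E\<close> is the expansion of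
    \<open>t ^ (p - 1) / (1 + t ^ p)\<close>.\<close>
  define E :: "'a fps" where "E = Abs_fps (\<lambda>k. if p dvd Suc k then (-1) ^ k else 0)"
  define B where "B = fps_binomial r"
  define Q :: "'a fps" where "Q = 1 + fps_X ^ p"
  have "p > 0"
    using assms by (rule odd_pos)
  have E: "E * Q = fps_X ^ (p - 1)"
  proof (rule fps_ext)
    fix n
    have "(E * Q) $ n = E $ n + (if n < p then 0 else E $ (n - p))"
      by (simp add: Q_def distrib_left fps_X_power_mult_right_nth)
    also have "\<dots> = (fps_X ^ (p - 1)) $ n"
    proof (cases "n < p")
      case True
      have "p dvd Suc n \<longleftrightarrow> n = p - 1"
        using True \<open>p > 0\<close> by (auto dest: dvd_imp_le)
      thus ?thesis
        using True assms by (auto simp: E_def fps_X_power_nth)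
    next
      case False
      have "p dvd Suc n \<longleftrightarrow> p dvd Suc (n - p)"
      proof -
        have "Suc n = Suc (n - p) + p"
          using False by simp
        thus ?thesis
          by (metis dvd_add_triv_right_iff)
      qed
      moreover have "(-1 :: 'a) ^ n = - ((-1) ^ (n - p))"
        using assms False by
          (metis le_add_diff_inverse mult_minus1 power_add power_minus_odd power_one linorder_not_less)
      ultimately show ?thesis
        using False \<open>p > 0\<close> by (auto simp: E_def fps_X_power_nth)
    qed
    finally show "(E * Q) $ n = (fps_X ^ (p - 1)) $ n" .
  qed
  define R :: "'a fps" where "R = fps_const r * Abs_fps (\<lambda>k. (-1) ^ k)"
  have B': "fps_deriv B = R * B"
    unfolding B_def fps_binomial_deriv R_def
    by (subst fps_divide_unit) (simp_all add: fps_inverse_fps_X_plus1)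
  have Q': "fps_deriv (Q ^ s) = of_nat (p * s) * E * Q ^ s"
  proof (cases s)
    case (Suc t)
    have "fps_deriv (Q ^ s) = of_nat s * (of_nat p * fps_X ^ (p - 1)) * Q ^ t"
      unfolding fps_deriv_power' by (simp add: Suc Q_def fps_deriv_power')
    thus ?thesis
      unfolding E[symmetric] by (simp add: Suc algebra_simps)
  qed simp
  have "Abs_fps (\<lambda>k. (-1) ^ k * (r + (if p dvd Suc k then of_nat (p * s) else 0)))
          = R + of_nat (p * s) * E"
    by (rule fps_ext) (simp add: R_def E_def fps_of_nat[symmetric] algebra_simps del: of_nat_mult)
  thus ?thesis
    unfolding B_def[symmetric] Q_def[symmetric]
    by (simp add: B' Q' algebra_simps)
qed

text \<open>In characteristic zero the power sums determine the product, since it solves a linear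
  differential equation built from them. The generalized binomial coefficient covers negative
  \<open>r\<close> (a negative Gauss sum) and \<open>r = 0\<close> (linear characters).\<close>

lemma elem_sym_of_power_sums:
  fixes f :: "'a :: finite \<Rightarrow> 'b :: field_char_0"
  assumes "odd p"
    and power_sum: "\<And>m. m \<ge> 1 \<Longrightarrow> (\<Sum>x\<in>UNIV. f x ^ m) = r + (if p dvd m then of_nat (p * s) else 0)"
  shows "elem_sym f n =
           (\<Sum>(i, j) \<in> {(i, j). i + p * j = n}. (r gchoose i) * of_nat (s choose j))"
proof -
  have "p > 0"
    using assms by (auto intro: odd_pos)
  have power_sum_Suc:
    "(\<Sum>x\<in>UNIV. f x ^ Suc k) = r + (if p dvd Suc k then of_nat (p * s) else 0)" for k
    by (rule power_sum) simp
  have "(\<Prod>x\<in>UNIV. 1 + fps_const (f x) * fps_X) = fps_binomial r * (1 + fps_X ^ p) ^ s"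
  proof (rule fps_linear_ode_unique)
    show "fps_deriv (\<Prod>x\<in>UNIV. 1 + fps_const (f x) * fps_X) =
      Abs_fps (\<lambda>k. (-1) ^ k * (r + (if p dvd Suc k then of_nat (p * s) else 0)))
        * (\<Prod>x\<in>UNIV. 1 + fps_const (f x) * fps_X)"
      using fps_deriv_prod_linear[of UNIV f] by (simp only: finite power_sum_Suc)
    show "(\<Prod>x\<in>UNIV. 1 + fps_const (f x) * fps_X) $ 0 = (fps_binomial r * (1 + fps_X ^ p) ^ s) $ 0"
    proof -
      have "(\<Prod>x\<in>A. 1 + fps_const (f x) * fps_X) $ 0 = 1" for A
        by (induction A rule: infinite_finite_induct) auto
      thus ?thesis
        using \<open>p > 0\<close> by (simp add: fps_nth_power_0 power_0_left)
    qed
  qed (rule fps_deriv_binomial_power[OF assms(1)])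
  hence "elem_sym f n = ((1 + fps_X ^ p) ^ s * fps_binomial r) $ n"
    by (simp add: elem_sym_eq_fps_nth mult.commute)
  also have "(1 + fps_X ^ p :: 'b fps) ^ s = (\<Sum>j\<le>s. fps_const (of_nat (s choose j)) * fps_X ^ (p * j))"
    by (subst add.commute, subst binomial_ring) (simp add: fps_of_nat power_mult)
  also have "(\<dots> * fps_binomial r) $ n =
      (\<Sum>j\<le>s. if n < p * j then 0 else of_nat (s choose j) * (r gchoose (n - p * j)))"
    by (simp add: sum_distrib_right fps_sum_nth mult.assoc fps_X_power_mult_nth if_distrib cong: if_cong)
  also have "\<dots> = (\<Sum>j | p * j \<le> n. of_nat (s choose j) * (r gchoose (n - p * j)))"
  proof -
    have fin: "finite {j. p * j \<le> n}"
      by (rule finite_subset[of _ "{..n}"]) (use \<open>p > 0\<close> in \<open>auto intro: order_trans[rotated]\<close>)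
    have "(\<Sum>j | p * j \<le> n. of_nat (s choose j) * (r gchoose (n - p * j)))
        = (\<Sum>j\<in>{..s} \<inter> {j. p * j \<le> n}. of_nat (s choose j) * (r gchoose (n - p * j)))"
      by (rule sum.mono_neutral_right[OF fin]) (auto simp: binomial_eq_0_iff)
    thus ?thesis
      by (auto simp: sum.inter_restrict intro!: sum.cong)
  qed
  also have "\<dots> = (\<Sum>(i, j) \<in> {(i, j). i + p * j = n}. (r gchoose i) * of_nat (s choose j))"
    by (rule sum.reindex_bij_witness[of _ snd "\<lambda>j. (n - p * j, j)"]) auto
  finally show ?thesis .
qed

subsection \<open>Finite fields\<close>

text \<open>Multiplication by \<open>x\<close> permutes the nonzero elements, so it preserves their
  product.\<close>

lemma finite_field_power_card_minus_1:
  fixes x :: "'a :: {field, finite}"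
  assumes "x \<noteq> 0"
  shows "x ^ (CARD('a) - 1) = 1"
proof -
  have "\<Prod>(UNIV - {0 :: 'a}) = (\<Prod>y\<in>UNIV - {0}. x * y)"
    by (rule prod.reindex_bij_witness[of _ "\<lambda>y. x * y" "\<lambda>y. y / x"]) (use assms in auto)
  also have "\<dots> = x ^ (CARD('a) - 1) * \<Prod>(UNIV - {0})"
    by (simp add: prod.distrib)
  finally show ?thesis
    by simp
qed

lemma finite_field_power_card:
  fixes x :: "'a :: {field, finite}"
  shows "x ^ CARD('a) = x"
proof (cases "x = 0")
  case False
  have "x ^ CARD('a) = x * x ^ (CARD('a) - 1)"
    by (metis power_eq_if zero_less_card_finite less_not_refl)
  thus ?thesis
    using False finite_field_power_card_minus_1 by simp
qed (simp add: power_0_left)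

lemma prime_CHAR_finite_field: "prime CHAR('a :: {field, finite})"
  by (intro prime_CHAR_semidom finite_imp_CHAR_pos) auto

text \<open>Translation by 1 permutes the field; comparing the sums of all elements shows that the
  cardinality is zero in the field.\<close>

lemma finite_field_CHAR:
  assumes "prime p" "CARD('a :: {field, finite}) = p ^ k"
  shows "CHAR('a) = p"
proof -
  have "(\<Sum>x\<in>UNIV. x + 1 :: 'a) = (\<Sum>x\<in>UNIV. x)"
    by (rule sum.reindex_bij_witness[of _ "\<lambda>x. x - 1" "\<lambda>x. x + 1"]) auto
  hence "of_nat CARD('a) = (0 :: 'a)"
    by (simp add: sum.distrib)
  hence "CHAR('a) dvd p ^ k"
    using assms by (simp add: of_nat_eq_0_iff_char_dvd flip: of_nat_power)
  thus ?thesis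
    using assms prime_CHAR_finite_field by (metis prime_dvd_power primes_dvd_imp_eq)
qed

lemma of_nat_power_CHAR:
  "(of_nat k :: 'a :: {field, finite}) ^ CHAR('a) = of_nat k"
  using prime_CHAR_finite_field[where 'a = 'a]
  by (induction k) (auto simp: freshmans_dream power_0_left)

section \<open>Root counting, the prime subfield and squares\<close>

lemma card_power_eq_le:
  fixes c :: "'a :: idom"
  assumes "0 < k" "k < m"
  shows "card {x. x ^ m + a * x ^ k = c} \<le> m"
proof -
  define P where "P = monom 1 m + monom a k + [:-c:]"
  have "degree (monom a k + [:-c:]) < m"
    using assms by (intro degree_add_less le_less_trans[OF degree_monom_le]) auto
  hence deg: "degree P = m"
    by (simp add: P_def add.assoc degree_add_eq_left degree_monom_eq)
  hence "P \<noteq> 0"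
    using assms by auto
  moreover have "poly P x = 0 \<longleftrightarrow> x ^ m + a * x ^ k = c" for x
    by (auto simp: P_def poly_monom)
  ultimately show ?thesis
    using card_poly_roots_bound[of P] deg by simp
qed

text \<open>The images of \<open>0, ..., p - 1\<close> are already \<open>p\<close> distinct roots
  of \<open>x ^ p - x\<close>, which has at most \<open>p\<close> roots.\<close>

lemma prime_subfield_eq:
  fixes x :: "'a :: {field, finite}"
  assumes "CHAR('a) = p" and "x ^ p = x"
  obtains k where "x = of_nat k"
proof -
  have p: "prime p"
    using assms prime_CHAR_finite_field by metis
  have Fermat: "(of_nat k :: 'a) ^ p = of_nat k" for k
    using of_nat_power_CHAR assms(1) by metis
  have inj: "inj_on (of_nat :: nat \<Rightarrow> 'a) {..<p}"
    using assms(1) by (auto simp: inj_on_def of_nat_eq_iff_cong_CHAR cong_def)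
  have "of_nat ` {..<p} = {x :: 'a. x ^ p + (-1) * x ^ 1 = 0}"
  proof (rule card_subset_eq)
    show "card (of_nat ` {..<p} :: 'a set) = card {x :: 'a. x ^ p + (-1) * x ^ 1 = 0}"
    proof (rule antisym)
      show "card (of_nat ` {..<p} :: 'a set) \<le> card {x :: 'a. x ^ p + (-1) * x ^ 1 = 0}"
        by (rule card_mono) (auto simp: Fermat)
      show "card {x :: 'a. x ^ p + (-1) * x ^ 1 = 0} \<le> card (of_nat ` {..<p} :: 'a set)"
        using card_power_eq_le[of 1 p "-1 :: 'a" 0] prime_gt_1_nat[OF p] inj by (simp add: card_image)
    qed
  qed (auto simp: Fermat)
  moreover have "x \<in> {x :: 'a. x ^ p + (-1) * x ^ 1 = 0}"
    using assms by simp
  ultimately show thesis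
    using that by blast
qed

text \<open>Squaring is at most two-to-one, so there are at least \<open>h\<close> nonzero squares,
  where \<open>2 * h\<close> is the number of nonzero elements. All of them are roots of
  \<open>x ^ h = 1\<close>, which has at most \<open>h\<close> roots.\<close>

lemma euler_criterion_finite_field:
  fixes c :: "'a :: {field, finite}"
  assumes "odd CARD('a)" and c: "c ^ ((CARD('a) - 1) div 2) = 1"
  obtains d where "c = d ^ 2"
proof -
  define h where "h = (CARD('a) - 1) div 2"
  have h: "CARD('a) - 1 = 2 * h"
    using assms by (simp add: h_def)
  have "card {0, 1 :: 'a} \<le> CARD('a)"
    by (rule card_mono) auto
  hence "h > 0"
    using h assms by (cases "h = 0") auto
  define Q where "Q = (\<lambda>x :: 'a. x ^ 2) ` (UNIV - {0})"
  have "2 * h = card (UNIV - {0 :: 'a})"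
    using h by (simp add: card_Diff_singleton)
  also have "UNIV - {0 :: 'a} \<subseteq> (\<Union>y\<in>Q. {x. x ^ 2 = y})"
    by (auto simp: Q_def)
  hence "card (UNIV - {0 :: 'a}) \<le> card (\<Union>y\<in>Q. {x. x ^ 2 = y})"
    by (intro card_mono) auto
  also have "\<dots> \<le> (\<Sum>y\<in>Q. card {x. x ^ 2 = y})"
    by (rule card_UN_le) simp
  also have "\<dots> \<le> (\<Sum>y\<in>Q. 2)"
    using card_power_eq_le[of 1 2 0] by (intro sum_mono) simp
  finally have "h \<le> card Q"
    by simp
  have "Q \<subseteq> {x. x ^ h = 1}"
    using finite_field_power_card_minus_1[where 'a = 'a] unfolding h
    by (auto simp: Q_def simp flip: power_mult)
  moreover have "card {x :: 'a. x ^ h = 1} \<le> h"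
  \<comment> \<open>The root bound is applied with lower exponent 1, so it needs
    \<open>h > 1\<close>.\<close>
  proof (cases "h = 1")
    case False
    thus ?thesis
      using card_power_eq_le[of 1 h 0 "1 :: 'a"] \<open>h > 0\<close> by simp
  qed simp
  ultimately have "Q = {x. x ^ h = 1}"
    using \<open>h \<le> card Q\<close> by (intro card_seteq) auto
  thus thesis
    using c that by (auto simp: Q_def h_def)
qed

text \<open>The even degree enters here: \<open>p ^ 2 - 1\<close> divides \<open>q - 1\<close> and
  \<open>p + 1\<close> is even, so \<open>(q - 1) / 2\<close> is a multiple of \<open>p - 1\<close>.
  Fermat's little theorem then yields Euler's criterion.\<close>

lemma prime_subfield_square:
  assumes "prime p" "odd p" "CARD('a) = p ^ (2 * e)" "e \<ge> 1"
  obtains d :: "'a :: {field, finite}" where "of_nat k = d ^ 2"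
proof (cases "p dvd k")
  case True
  hence "of_nat k = (0 :: 'a) ^ 2"
    using finite_field_CHAR[OF assms(1,3)] by (simp add: of_nat_eq_0_iff_char_dvd)
  thus ?thesis
    by (rule that)
next
  case False
  have "(of_nat k :: 'a) \<noteq> 0"
    using False finite_field_CHAR[OF assms(1,3)] by (simp add: of_nat_eq_0_iff_char_dvd)
  moreover have "(of_nat k :: 'a) * of_nat k ^ (p - 1) = of_nat k"
    using of_nat_power_CHAR[of k, where 'a = 'a] finite_field_CHAR[OF assms(1,3)] prime_gt_0_nat[OF assms(1)]
    by (metis power_eq_if less_not_refl)
  ultimately have Fermat: "(of_nat k :: 'a) ^ (p - 1) = 1"
    by simp
  \<comment> \<open>With the geometric sum for \<open>(p ^ 2) ^ e - 1\<close>, this is the cofactor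
    in \<open>(q - 1) / 2 = (p - 1) * h\<close>.\<close>
  define h where "h = (p + 1) div 2 * (\<Sum>i<e. (p ^ 2) ^ i)"
  have "int (p ^ (2 * e)) - 1 = (int p - 1) * (int p + 1) * (\<Sum>i<e. (int p ^ 2) ^ i)"
    using power_diff_1_eq[of "int p ^ 2" e] by (simp add: power_mult power2_eq_square algebra_simps)
  also have "int p + 1 = 2 * int ((p + 1) div 2)"
    using assms(2) by presburger
  also have "int p - 1 = int (p - 1)"
    using prime_gt_0_nat[OF assms(1)] by linarith
  finally have "int (p ^ (2 * e)) - 1 = int ((p - 1) * h * 2)"
    by (simp only: h_def of_nat_mult of_nat_sum of_nat_power of_nat_numeral mult_ac)
  hence "CARD('a) - 1 = (p - 1) * h * 2"
    using assms(3) by linarith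
  hence "(of_nat k :: 'a) ^ ((CARD('a) - 1) div 2) = 1"
    by (simp add: power_mult Fermat del: One_nat_def)
  moreover have "odd CARD('a)"
    using assms by simp
  ultimately show ?thesis
    using euler_criterion_finite_field that by blast
qed

text \<open>The character is \<open>x \<mapsto> exp (2 \<pi> i Tr(x) / p)\<close>; the trace is not identically zero because it is a
  polynomial of degree less than \<open>p\<^sup>m\<close>.\<close>
lemma nontrivial_additive_character_exists:
  assumes "prime p" "CARD('a) = p ^ m" "m \<ge> 1"
  obtains \<psi> :: "'a :: {field, finite} \<Rightarrow> complex" where
    "\<And>x y. \<psi> (x + y) = \<psi> x * \<psi> y" "\<And>x. norm (\<psi> x) = 1" "\<exists>x. \<psi> x \<noteq> 1"
proof -
  have char: "CHAR('a) = p"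
    using assms(1,2) by (rule finite_field_CHAR)
  define Tr :: "'a \<Rightarrow> 'a" where "Tr x = (\<Sum>i<m. x ^ (p ^ i))" for x
  have Tr_add: "Tr (x + y) = Tr x + Tr y" for x y
    using assms char by (simp add: Tr_def freshmans_dream' sum.distrib)
  \<comment> \<open>Frobenius shifts the summands cyclically because \<open>x ^ (p ^ m) = x\<close>;
    hence the trace lies in the prime field.\<close>
  have "Tr x ^ p = Tr x" for x
  proof -
    have "Tr x ^ p = (\<Sum>i<m. x ^ (p ^ Suc i))"
      unfolding Tr_def using assms char
      by (simp add: freshmans_dream_sum mult.commute flip: power_mult)
    also have "\<dots> = (\<Sum>i<Suc m. x ^ (p ^ i)) - x"
      by (subst sum.lessThan_Suc_shift) simp
    also have "\<dots> = Tr x"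
      using finite_field_power_card[of x] by (simp add: Tr_def assms)
    finally show ?thesis .
  qed
  hence "\<exists>k. Tr x = of_nat k" for x
    using prime_subfield_eq[OF char] by metis
  \<comment> \<open>The representative \<open>k x\<close> matters only modulo \<open>p\<close>,
    which \<open>cis_cong\<close> makes precise.\<close>
  then obtain k where k: "Tr x = of_nat (k x)" for x
    by metis
  define \<psi> where "\<psi> x = cis (2 * pi * real (k x) / real p)" for x
  have "p > 0" "p > 1"
    using assms prime_gt_1_nat[of p] by auto
  have cis_cong: "cis (2 * pi * real i / real p) = cis (2 * pi * real j / real p) \<longleftrightarrow> [i = j] (mod p)" for i j
  proof -
    have "cis (2 * pi * real i / real p) = cis (2 * pi * real (i mod p) / real p)" for i
    proof -
      have "real i = real p * real (i div p) + real (i mod p)"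
        by (metis mult_div_mod_eq of_nat_add of_nat_mult)
      hence "2 * pi * real i / real p = 2 * pi * real (i div p) + 2 * pi * real (i mod p) / real p"
        using \<open>p > 0\<close> by (simp add: field_simps)
      thus ?thesis
        by (simp add: cis_multiple_2pi flip: cis_mult)
    qed
    moreover have "cis (2 * pi * real (i mod p) / real p) = cis (2 * pi * real (j mod p) / real p)
                     \<longleftrightarrow> i mod p = j mod p"
      using bij_betw_roots_unity[OF \<open>p > 0\<close>] \<open>p > 0\<close> by (auto simp: bij_betw_def inj_on_def)
    ultimately show ?thesis
      by (simp add: cong_def)
  qed
  show thesis
  proof
    fix x y
    have "(of_nat (k (x + y)) :: 'a) = of_nat (k x + k y)"
      using Tr_add[of x y] by (simp add: k)
    hence "[k (x + y) = k x + k y] (mod p)"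
      by (simp only: of_nat_eq_iff_cong_CHAR char)
    thus "\<psi> (x + y) = \<psi> x * \<psi> y"
      unfolding \<psi>_def cis_cong[symmetric] by (simp add: cis_mult ring_distribs add_divide_distrib)
    show "norm (\<psi> x) = 1"
      by (simp add: \<psi>_def)
  next
    show "\<exists>x. \<psi> x \<noteq> 1"
    proof (rule ccontr)
      assume "\<not> ?thesis"
      hence "cis (2 * pi * real (k x) / real p) = cis (2 * pi * real 0 / real p)" for x
        by (simp add: \<psi>_def)
      hence "(of_nat (k x) :: 'a) = of_nat 0" for x
        unfolding cis_cong of_nat_eq_iff_cong_CHAR char .
      hence Tr_0: "Tr x = 0" for x
        by (simp add: k)
      define P :: "'a poly" where "P = (\<Sum>i<m. monom 1 (p ^ i))"
      have "poly P x = 0" for x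
        using Tr_0[of x] by (simp add: P_def Tr_def poly_sum poly_monom)
      moreover have "coeff P 1 = 1"
      proof -
        have "coeff P 1 = (\<Sum>i<m. if i = 0 then 1 else 0)"
          unfolding P_def coeff_sum using \<open>p > 1\<close> by (intro sum.cong) auto
        thus ?thesis
          using assms by simp
      qed
      hence "P \<noteq> 0"
        by auto
      moreover have "degree P < p ^ m"
        unfolding P_def using \<open>p > 1\<close> \<open>m \<ge> 1\<close>
        by (intro degree_sum_less) (auto intro: le_less_trans[OF degree_monom_le])
      ultimately show False
        using card_poly_roots_bound[of P] assms by simp
    qed
  qed
qed

subsection \<open>Quadratic Gauss sums over a field of even degree\<close>

locale finite_field_character =
  fixes \<psi> :: "'a :: {field, finite} \<Rightarrow> complex" and p e q :: nat
  assumes prime: "prime p" and odd: "odd p" and e: "e \<ge> 1" and q_def: "q = p ^ (2 * e)"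
    and card: "CARD('a) = q"
    and char_add: "\<psi> (x + y) = \<psi> x * \<psi> y" and char_norm: "norm (\<psi> x) = 1" and nontrivial: "\<exists>x. \<psi> x \<noteq> 1"
begin

lemma card_power: "CARD('a) = p ^ (2 * e)"
  using card q_def by simp

lemma q_pos: "q \<ge> 1"
  using card finite_UNIV_card_ge_0[where 'a = 'a] by simp

lemma of_nat_q_minus_1: "(of_nat (q - Suc 0) :: complex) = of_nat q - 1"
  using q_pos of_nat_diff[of 1 q, where 'a = complex] by simp

lemma q_eq_square: "of_nat q = (of_nat (p ^ e) :: complex) ^ 2"
  unfolding q_def power_mult by (simp flip: power_mult add: mult.commute)

lemma of_nat_eq_0_iff: "of_nat k = (0 :: 'a) \<longleftrightarrow> p dvd k"
  using finite_field_CHAR[OF prime card_power] by (simp add: of_nat_eq_0_iff_char_dvd)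

lemma two_neq_0: "(2 :: 'a) \<noteq> 0"
  using of_nat_eq_0_iff[of 2] prime odd by (auto dest: primes_dvd_imp_eq[OF _ two_is_prime_nat])

lemma char_0 [simp]: "\<psi> 0 = 1"
  using char_add[of 0 0] char_norm[of 0] by auto

lemma char_power: "\<psi> x ^ m = \<psi> (of_nat m * x)"
  by (induction m) (simp_all add: char_add distrib_right)

lemma char_sum: "\<psi> (\<Sum>x\<in>A. f x) = (\<Prod>x\<in>A. \<psi> (f x))"
  by (induction A rule: infinite_finite_induct) (simp_all add: char_add)

text \<open>Orthogonality: if \<open>\<psi> z \<noteq> 1\<close>, shifting \<open>x\<close> by
  \<open>z / c\<close> multiplies the sum by \<open>\<psi> z\<close>, so the sum vanishes.\<close>

lemma char_sum_linear: "(\<Sum>x\<in>UNIV. \<psi> (c * x)) = (if c = 0 then of_nat q else 0)"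
proof (cases "c = 0")
  case False
  obtain z where z: "\<psi> z \<noteq> 1"
    using nontrivial by blast
  have "(\<Sum>x\<in>UNIV. \<psi> (c * x)) = (\<Sum>x\<in>UNIV. \<psi> (c * (x + z / c)))"
    by (rule sum.reindex_bij_witness[of _ "\<lambda>x. x + z / c" "\<lambda>x. x - z / c"]) auto
  also have "\<dots> = \<psi> z * (\<Sum>x\<in>UNIV. \<psi> (c * x))"
    using False by (simp add: distrib_left char_add sum_distrib_left mult.commute)
  finally show ?thesis
    using z False by simp
qed (simp add: card)

text \<open>The case \<open>a = 0\<close> is included with value \<open>q\<close>; it supplies the
  power sums whose exponent is divisible by \<open>p\<close>.\<close>

definition gauss_sum :: "'a \<Rightarrow> complex" where
  "gauss_sum a = (\<Sum>x\<in>UNIV. \<psi> (a * x ^ 2))"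

lemma gauss_sum_0 [simp]: "gauss_sum 0 = of_nat q"
  by (simp add: gauss_sum_def card)

lemma gauss_sum_mult_square:
  assumes "c \<noteq> 0"
  shows "gauss_sum (a * c ^ 2) = gauss_sum a"
  unfolding gauss_sum_def
  by (rule sum.reindex_bij_witness[of _ "\<lambda>x. x / c" "\<lambda>x. c * x"])
     (use assms in \<open>auto simp: power_mult_distrib mult_ac\<close>)

lemma gauss_sum_of_nat_mult:
  assumes "\<not> p dvd k"
  shows "gauss_sum (of_nat k * a) = gauss_sum a"
proof -
  obtain d :: 'a where d: "of_nat k = d ^ 2"
    using prime_subfield_square[OF prime odd card_power e] .
  moreover have "d \<noteq> 0"
    using d assms of_nat_eq_0_iff[of k] by auto
  ultimately show ?thesis
    by (simp add: gauss_sum_mult_square mult.commute)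
qed

text \<open>In the field, \<open>-1\<close> is the image of \<open>p - 1\<close>, which is prime to
  \<open>p\<close>.\<close>

lemma gauss_sum_minus: "gauss_sum (- a) = gauss_sum a"
proof -
  have "(of_nat (p - 1) :: 'a) + 1 = 0"
    using of_nat_eq_0_iff[of p] prime_gt_0_nat[OF prime]
    by (metis Suc_diff_1 add.commute dvd_refl of_nat_Suc)
  hence "(of_nat (p - 1) :: 'a) = - 1"
    by (simp add: eq_neg_iff_add_eq_0)
  moreover have "\<not> p dvd p - 1"
    using prime_gt_1_nat[OF prime] by (auto dest: dvd_imp_le)
  ultimately show ?thesis
    using gauss_sum_of_nat_mult[of "p - 1" a] by simp
qed

text \<open>In the double sum for \<open>gauss_sum a * gauss_sum (- a)\<close>, the substitution
  \<open>x = u + y\<close> makes the exponent linear in \<open>y\<close>. Summing over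
  \<open>y\<close> leaves only \<open>u = 0\<close>.\<close>

lemma gauss_sum_square:
  assumes "a \<noteq> 0"
  shows "gauss_sum a ^ 2 = of_nat q"
proof -
  have "gauss_sum a ^ 2 = gauss_sum a * gauss_sum (- a)"
    by (simp add: gauss_sum_minus power2_eq_square)
  also have "\<dots> = (\<Sum>y\<in>UNIV. \<Sum>x\<in>UNIV. \<psi> (a * (x ^ 2 - y ^ 2)))"
    unfolding gauss_sum_def sum_product
    by (subst sum.swap) (simp add: algebra_simps flip: char_add)
  also have "\<dots> = (\<Sum>y\<in>UNIV. \<Sum>u\<in>UNIV. \<psi> (a * ((u + y) ^ 2 - y ^ 2)))"
  proof (rule sum.cong[OF refl])
    fix y
    show "(\<Sum>x\<in>UNIV. \<psi> (a * (x ^ 2 - y ^ 2))) = (\<Sum>u\<in>UNIV. \<psi> (a * ((u + y) ^ 2 - y ^ 2)))"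
      by (rule sum.reindex_bij_witness[of _ "\<lambda>x. x + y" "\<lambda>x. x - y"]) auto
  qed
  also have "\<dots> = (\<Sum>u\<in>UNIV. \<Sum>y\<in>UNIV. \<psi> (a * u ^ 2) * \<psi> (2 * a * u * y))"
    by (subst sum.swap) (simp add: power2_eq_square algebra_simps flip: char_add)
  also have "\<dots> = (\<Sum>u\<in>UNIV. \<psi> (a * u ^ 2) * (if 2 * a * u = 0 then of_nat q else 0))"
    by (simp only: sum_distrib_left[symmetric] char_sum_linear)
  also have "\<dots> = (\<Sum>u :: 'a\<in>UNIV. if u = 0 then of_nat q else 0)"
    using assms two_neq_0 by (intro sum.cong) auto
  finally show ?thesis
    by simp
qed

lemma gauss_sum_cases:
  assumes "a \<noteq> 0"
  shows "gauss_sum a = of_nat (p ^ e) \<or> gauss_sum a = - of_nat (p ^ e)"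
  using gauss_sum_square[OF assms] unfolding q_eq_square by (simp add: power2_eq_iff)

text \<open>Both signs occur equally often: the Gauss sums over all \<open>a\<close> add up to
  \<open>q\<close>, and \<open>a = 0\<close> alone contributes that much.\<close>

lemma sum_over_gauss_sums:
  fixes F :: "complex \<Rightarrow> complex"
  shows "(\<Sum>a\<in>UNIV - {0}. F (gauss_sum a)) =
           (of_nat q - 1) / 2 * (F (of_nat (p ^ e)) + F (- of_nat (p ^ e)))"
proof -
  define r :: complex where "r = of_nat (p ^ e)"
  have "r \<noteq> 0"
    using prime_gt_0_nat[OF prime] by (simp add: r_def)
  define A where "A = {a. a \<noteq> 0 \<and> gauss_sum a = r}"
  define B where "B = {a. a \<noteq> 0 \<and> gauss_sum a = - r}"
  have disj: "A \<inter> B = {}"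
    using \<open>r \<noteq> 0\<close> by (auto simp: A_def B_def)
  have UN: "UNIV - {0} = A \<union> B"
    using gauss_sum_cases by (auto simp: A_def B_def r_def)
  \<comment> \<open>Taking the identity for \<open>F\<close> compares the sizes of \<open>A\<close>
    and \<open>B\<close>; taking the constant 1 gives their total \<open>q - 1\<close>.\<close>
  have split: "(\<Sum>a\<in>UNIV - {0}. F (gauss_sum a)) = of_nat (card A) * F r + of_nat (card B) * F (- r)"
    for F :: "complex \<Rightarrow> complex"
    unfolding UN using disj by (subst sum.union_disjoint) (auto simp: A_def B_def)
  have "(\<Sum>a\<in>UNIV. gauss_sum a) = (\<Sum>x\<in>UNIV. \<Sum>a\<in>UNIV. \<psi> (x ^ 2 * a))"
    unfolding gauss_sum_def by (subst sum.swap) (simp add: mult.commute)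
  also have "\<dots> = (\<Sum>x :: 'a\<in>UNIV. if x = 0 then of_nat q else 0)"
    unfolding char_sum_linear by (intro sum.cong) auto
  finally have "(\<Sum>a\<in>UNIV. gauss_sum a) = of_nat q"
    by simp
  hence "(\<Sum>a\<in>UNIV - {0}. gauss_sum a) = 0"
    by (subst (asm) sum.remove[of _ 0]) auto
  hence "of_nat (card A) * r = of_nat (card B) * r"
    using split[of "\<lambda>x. x"] by simp
  hence AB: "(of_nat (card A) :: complex) = of_nat (card B)"
    using \<open>r \<noteq> 0\<close> by simp
  have "(of_nat q :: complex) - 1 = of_nat (card A) + of_nat (card B)"
    using split[of "\<lambda>_. 1"] by (simp add: card_Diff_singleton card of_nat_q_minus_1)
  hence cards: "of_nat (card A) = (of_nat q - 1 :: complex) / 2" "of_nat (card B) = (of_nat q - 1 :: complex) / 2"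
    using AB by simp_all
  thus ?thesis
    unfolding split cards r_def[symmetric] by (simp only: distrib_left)
qed

section \<open>Elementary symmetric functions of character values\<close>

lemma power_sum_quadratic:
  "(\<Sum>x\<in>UNIV. \<psi> (a * x ^ 2) ^ m) = gauss_sum (of_nat m * a)"
  by (simp add: char_power gauss_sum_def mult.assoc)

text \<open>The assumption makes \<open>s\<close> equal to \<open>(q - g) / p\<close> for the Gauss
  sum \<open>g\<close>. The \<open>m\<close>-th power sum is \<open>g\<close> if \<open>p\<close>
  does not divide \<open>m\<close>, and \<open>q = g + p * s\<close> otherwise.\<close>

lemma elem_sym_quadratic:
  assumes "of_nat (p * s) = of_nat q - gauss_sum a"
  shows "elem_sym (\<lambda>x. \<psi> (a * x ^ 2)) n =
           (\<Sum>(i, j) \<in> {(i, j). i + p * j = n}. (gauss_sum a gchoose i) * of_nat (s choose j))"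
proof (rule elem_sym_of_power_sums[OF odd])
  fix m :: nat
  show "(\<Sum>x\<in>UNIV. \<psi> (a * x ^ 2) ^ m) = gauss_sum a + (if p dvd m then of_nat (p * s) else 0)"
    unfolding power_sum_quadratic using assms gauss_sum_of_nat_mult[of m a] of_nat_eq_0_iff[of m] by auto
qed

lemma elem_sym_quadratic_pos:
  assumes "gauss_sum a = of_nat (p ^ e)"
  shows "elem_sym (\<lambda>x. \<psi> (a * x ^ 2)) n = of_nat (alpha p e n)"
proof -
  define s where "s = (p ^ (2 * e) - p ^ e) div p"
  have "p ^ e \<le> p ^ (2 * e)"
    using prime_gt_0_nat[OF prime] by (intro power_increasing) auto
  moreover have "p dvd p ^ (2 * e) - p ^ e"
    using e by (intro dvd_diff_nat dvd_power) auto
  hence "p * s = p ^ (2 * e) - p ^ e"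
    by (simp add: s_def)
  ultimately have "of_nat (p * s) = of_nat q - gauss_sum a"
    unfolding assms q_def by (simp add: of_nat_diff)
  hence "elem_sym (\<lambda>x. \<psi> (a * x ^ 2)) n =
           (\<Sum>(i, j) \<in> {(i, j). i + p * j = n}. of_nat ((p ^ e choose i) * (s choose j)))"
    by (subst elem_sym_quadratic) (simp_all add: assms binomial_gbinomial case_prod_unfold)
  also have "\<dots> = (\<Sum>(i, j) \<in> {(i, j). i + p * j = n \<and> i \<le> p ^ e}. of_nat ((p ^ e choose i) * (s choose j)))"
  proof (rule sum.mono_neutral_right)
    show "finite {(i, j). i + p * j = n}"
      by (rule finite_subset[of _ "{..n} \<times> {..n}"])
         (use prime_gt_0_nat[OF prime] in \<open>auto intro: trans_le_add2\<close>)
  qed (auto simp: binomial_eq_0_iff)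
  also have "\<dots> = of_nat (alpha p e n)"
    by (simp add: alpha_def s_def case_prod_unfold)
  finally show ?thesis .
qed

lemma elem_sym_quadratic_neg:
  assumes "gauss_sum a = - of_nat (p ^ e)"
  shows "elem_sym (\<lambda>x. \<psi> (a * x ^ 2)) n = (-1) ^ n * of_int (beta p e n)"
proof -
  define s where "s = (p ^ (2 * e) + p ^ e) div p"
  have "p dvd p ^ (2 * e) + p ^ e"
    using e by (intro dvd_add dvd_power) auto
  hence "p * s = p ^ (2 * e) + p ^ e"
    by (simp add: s_def)
  hence "of_nat (p * s) = of_nat q - gauss_sum a"
    unfolding assms q_def by simp
  moreover have "((- of_nat (p ^ e) :: complex) gchoose i) * of_nat (s choose j) =
      (-1) ^ n * of_int ((-1) ^ j * int (p ^ e - 1 + i choose (p ^ e - 1)) * int (s choose j))"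
    if "i + p * j = n" for i j
  proof -
    have "p ^ e > 0"
      using prime_gt_0_nat[OF prime] by simp
    hence "(of_nat (p ^ e - 1) :: complex) = of_nat (p ^ e) - 1"
      by (subst of_nat_diff) auto
    hence "(of_nat (p ^ e) + of_nat i - 1 :: complex) = of_nat (p ^ e - 1 + i)"
      by (simp only: of_nat_add) (simp only: algebra_simps)
    hence "((- of_nat (p ^ e) :: complex) gchoose i) = (-1) ^ i * of_nat (p ^ e - 1 + i choose i)"
      unfolding gbinomial_minus by (simp only: binomial_gbinomial)
    also have "p ^ e - 1 + i choose i = p ^ e - 1 + i choose (p ^ e - 1)"
      using binomial_symmetric[of i "p ^ e - 1 + i"] by simp
    \<comment> \<open>Since \<open>p\<close> is odd, \<open>n = i + p * j\<close> has the parity of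
      \<open>i + j\<close>.\<close>
    also have "(-1 :: complex) ^ i = (-1) ^ n * (-1) ^ j"
      using that odd by (auto simp: minus_one_power_iff)
    finally show ?thesis
      by simp
  qed
  ultimately show ?thesis
    by (subst elem_sym_quadratic)
       (auto simp: assms beta_def s_def sum_distrib_left of_int_sum case_prod_unfold intro!: sum.cong)
qed

text \<open>The power sums are 0 or \<open>q\<close>, so the generating function is
  \<open>(1 + t ^ p) ^ (q div p)\<close>.\<close>

lemma elem_sym_linear:
  assumes "b \<noteq> 0"
  shows "elem_sym (\<lambda>x. \<psi> (b * x)) n = (if p dvd n then of_nat (q div p choose (n div p)) else 0)"
proof -
  have "p > 0"
    using prime_gt_0_nat[OF prime] .
  have "p dvd q"
    unfolding q_def using e by (intro dvd_power) auto
  have "elem_sym (\<lambda>x. \<psi> (b * x)) n =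
      (\<Sum>(i, j) \<in> {(i, j). i + p * j = n}. (0 gchoose i) * of_nat (q div p choose j))"
  proof (rule elem_sym_of_power_sums[OF odd])
    fix m :: nat
    have "(\<Sum>x\<in>UNIV. \<psi> (b * x) ^ m) = (\<Sum>x\<in>UNIV. \<psi> (of_nat m * b * x))"
      by (simp add: char_power mult.assoc)
    thus "(\<Sum>x\<in>UNIV. \<psi> (b * x) ^ m) = 0 + (if p dvd m then of_nat (p * (q div p)) else 0)"
      using \<open>p dvd q\<close> assms by (simp add: char_sum_linear of_nat_eq_0_iff)
  qed
  also have "\<dots> = (\<Sum>(i, j) \<in> {(i, j). i = 0 \<and> p * j = n}. (0 gchoose i) * of_nat (q div p choose j))"
  proof (rule sum.mono_neutral_right)
    show "finite {(i, j). i + p * j = n}"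
      by (rule finite_subset[of _ "{..n} \<times> {..n}"])
         (use \<open>p > 0\<close> in \<open>auto intro: trans_le_add2\<close>)
    have "(0 :: complex) gchoose i = (if i = 0 then 1 else 0)" for i
      by (cases i) auto
    thus "\<forall>i\<in>{(i, j). i + p * j = n} - {(i, j). i = 0 \<and> p * j = n}.
        (case i of (i, j) \<Rightarrow> ((0 :: complex) gchoose i) * of_nat (q div p choose j)) = 0"
      by (auto split: if_splits)
  qed auto
  also have "{(i :: nat, j). i = 0 \<and> p * j = n} = (if p dvd n then {(0, n div p)} else {})"
    using \<open>p > 0\<close> by auto
  finally show ?thesis
    by (simp split: if_splits)
qed

lemma elem_sym_const_1: "elem_sym (\<lambda>x :: 'a. 1 :: complex) n = of_nat (q choose n)"
  using n_subsets[of "UNIV :: 'a set" n] by (simp add: elem_sym_def card)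

text \<open>The shift of \<open>x\<close> by \<open>b / (2 * a)\<close> is a bijection, and the
  constant \<open>- (b ^ 2) / (4 * a)\<close> is picked up \<open>n\<close> times. The factor is
  written so that summing over \<open>b\<close> gives a Gauss sum.\<close>

lemma elem_sym_complete_square:
  assumes "a \<noteq> 0"
  shows "elem_sym (\<lambda>x. \<psi> (a * x ^ 2 + b * x)) n =
           \<psi> (- of_nat n / (4 * a) * b ^ 2) * elem_sym (\<lambda>x. \<psi> (a * x ^ 2)) n"
proof -
  have "(4 :: 'a) = 2 * 2"
    by simp
  hence four: "(4 :: 'a) \<noteq> 0"
    using two_neq_0 by (metis mult_eq_0_iff)
  have "a * x ^ 2 + b * x = - (b ^ 2) / (4 * a) + a * (x + b / (2 * a)) ^ 2" for x
  proof -
    define d where "d = b / (2 * a)"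
    have b: "b = 2 * a * d"
      using assms two_neq_0 by (simp add: d_def)
    have "b ^ 2 / (4 * a) = a * d ^ 2"
      using assms four by (simp add: b power2_eq_square)
    hence "- (b ^ 2) / (4 * a) + a * (x + d) ^ 2 = a * (x + d) ^ 2 - a * d ^ 2"
      by simp
    also have "\<dots> = a * x ^ 2 + b * x"
      unfolding b by (simp add: power2_eq_square algebra_simps)
    finally show ?thesis
      unfolding d_def ..
  qed
  hence "elem_sym (\<lambda>x. \<psi> (a * x ^ 2 + b * x)) n =
      \<psi> (- (b ^ 2) / (4 * a)) ^ n * elem_sym (\<lambda>x. \<psi> (a * (x + b / (2 * a)) ^ 2)) n"
    by (simp only: char_add elem_sym_scale)
  also have "elem_sym (\<lambda>x. \<psi> (a * (x + b / (2 * a)) ^ 2)) n = elem_sym (\<lambda>x. \<psi> (a * x ^ 2)) n"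
    by (rule elem_sym_bij) (rule bij_betw_byWitness[of _ "\<lambda>x. x - b / (2 * a)"], auto)
  finally show ?thesis
    by (simp add: char_power)
qed

text \<open>The scalars \<open>-1\<close> and \<open>n\<close> drop out when \<open>p\<close> does
  not divide \<open>n\<close>, and \<open>1 / (4 * a)\<close> differs from \<open>a\<close> by a
  square factor. If \<open>p\<close> divides \<open>n\<close> the argument is 0; this is the source
  of the two cases of the theorem.\<close>

lemma gauss_sum_shift:
  assumes "a \<noteq> 0"
  shows "gauss_sum (- of_nat n / (4 * a)) = (if p dvd n then of_nat q else gauss_sum a)"
proof (cases "p dvd n")
  case False
  have "gauss_sum (- of_nat n / (4 * a)) = gauss_sum (- (of_nat n * (1 / (4 * a))))"
    by simp
  also have "\<dots> = gauss_sum (1 / (4 * a))"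
    by (simp only: gauss_sum_minus gauss_sum_of_nat_mult[OF False])
  also have "1 / (4 * a) = a * (1 / (2 * a)) ^ 2"
    using assms by (simp add: power2_eq_square)
  also have "gauss_sum \<dots> = gauss_sum a"
    using assms two_neq_0 by (intro gauss_sum_mult_square) auto
  finally show ?thesis
    using False by simp
qed (use of_nat_eq_0_iff[of n] in simp)

section \<open>Counting subsets by orthogonality\<close>

lemma count_by_characters:
  "of_nat q ^ 2 * of_nat (M n (0 :: 'a) 0) =
     (\<Sum>a\<in>UNIV. \<Sum>b\<in>UNIV. elem_sym (\<lambda>x. \<psi> (a * x ^ 2 + b * x)) n)"
proof -
  have "(\<Prod>x\<in>S. \<psi> (a * x ^ 2 + b * x)) = \<psi> ((\<Sum>x\<in>S. x ^ 2) * a) * \<psi> ((\<Sum>x\<in>S. x) * b)" for S a b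
    unfolding char_add prod.distrib sum_distrib_right char_sum by (simp add: mult.commute)
  hence "(\<Sum>a\<in>UNIV. \<Sum>b\<in>UNIV. elem_sym (\<lambda>x. \<psi> (a * x ^ 2 + b * x)) n)
      = (\<Sum>a\<in>UNIV. \<Sum>b\<in>UNIV. \<Sum>S | card S = n. \<psi> ((\<Sum>x\<in>S. x ^ 2) * a) * \<psi> ((\<Sum>x\<in>S. x) * b))"
    by (simp only: elem_sym_def)
  also have "\<dots> = (\<Sum>a\<in>UNIV. \<Sum>S | card S = n. \<Sum>b\<in>UNIV. \<psi> ((\<Sum>x\<in>S. x ^ 2) * a) * \<psi> ((\<Sum>x\<in>S. x) * b))"
    by (intro sum.cong[OF refl] sum.swap)
  also have "\<dots> = (\<Sum>S | card S = n. (\<Sum>a\<in>UNIV. \<psi> ((\<Sum>x\<in>S. x ^ 2) * a)) * (\<Sum>b\<in>UNIV. \<psi> ((\<Sum>x\<in>S. x) * b)))"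
    by (subst sum.swap) (simp only: sum_product)
  also have "\<dots> = (\<Sum>S :: 'a set | card S = n. if (\<Sum>x\<in>S. x ^ 2) = 0 \<and> (\<Sum>x\<in>S. x) = 0 then of_nat q ^ 2 else 0)"
    unfolding char_sum_linear by (intro sum.cong) (auto simp: power2_eq_square)
  also have "\<dots> = of_nat q ^ 2 * of_nat (M n (0 :: 'a) 0)"
    by (simp add: sum.If_cases M_def Int_def mult.commute)
  finally show ?thesis ..
qed

text \<open>The pair \<open>a = b = 0\<close> gives \<open>q choose n\<close>, the pairs with only
  \<open>a = 0\<close> give the linear characters, and those with \<open>a \<noteq> 0\<close> reduce
  to Gauss sums.\<close>

lemma count_formula:
  "of_nat q ^ 2 * (of_nat (M n (0 :: 'a) 0) :: complex) =
     of_nat (q choose n)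
     + (if p dvd n then (of_nat q - 1) * of_nat (q div p choose (n div p)) else 0)
     + (of_nat q - 1) / 2 *
         (if p dvd n then of_nat q * (of_nat (alpha p e n) + (-1) ^ n * of_int (beta p e n))
          else of_nat (p ^ e) * (of_nat (alpha p e n) - (-1) ^ n * of_int (beta p e n)))"
proof -
  \<comment> \<open>The quadratic values depend on \<open>a\<close> only through its Gauss sum;
    expressing them by \<open>E\<close> makes \<open>sum_over_gauss_sums\<close> applicable.\<close>
  define E :: "complex \<Rightarrow> complex" where
    "E r = (if r = of_nat (p ^ e) then of_nat (alpha p e n) else (-1) ^ n * of_int (beta p e n))" for r
  define T where "T a = (\<Sum>b\<in>UNIV. elem_sym (\<lambda>x. \<psi> (a * x ^ 2 + b * x)) n)" for a
  have E: "elem_sym (\<lambda>x. \<psi> (a * x ^ 2)) n = E (gauss_sum a)" if "a \<noteq> 0" for a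
    using gauss_sum_cases[OF that] elem_sym_quadratic_pos[of a n] elem_sym_quadratic_neg[of a n]
    by (auto simp: E_def)
  have T: "T a = (if p dvd n then of_nat q else gauss_sum a) * E (gauss_sum a)" if "a \<noteq> 0" for a
  proof -
    have "T a = gauss_sum (- of_nat n / (4 * a)) * E (gauss_sum a)"
      unfolding T_def elem_sym_complete_square[OF that] E[OF that]
      by (simp only: gauss_sum_def sum_distrib_right)
    thus ?thesis
      by (simp only: gauss_sum_shift[OF that])
  qed
  have "T 0 = of_nat (q choose n)
              + (\<Sum>b\<in>UNIV - {0 :: 'a}. if p dvd n then of_nat (q div p choose (n div p)) else 0)"
    unfolding T_def by (subst sum.remove[of _ 0]) (simp_all add: elem_sym_const_1 elem_sym_linear)
  hence T0: "T 0 = of_nat (q choose n)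
              + (if p dvd n then (of_nat q - 1) * of_nat (q div p choose (n div p)) else 0)"
    by (simp add: card_Diff_singleton card of_nat_q_minus_1)
  have "p ^ e > 0"
    using prime_gt_0_nat[OF prime] by simp
  hence neg: "- of_nat (p ^ e) \<noteq> (of_nat (p ^ e) :: complex)"
    by (simp add: neg_eq_iff_add_eq_0)
  have "of_nat q ^ 2 * (of_nat (M n (0 :: 'a) 0) :: complex) = T 0 + (\<Sum>a\<in>UNIV - {0}. T a)"
    unfolding count_by_characters T_def by (rule sum.remove) auto
  also have "(\<Sum>a\<in>UNIV - {0}. T a) =
      (\<Sum>a\<in>UNIV - {0}. (if p dvd n then of_nat q else gauss_sum a) * E (gauss_sum a))"
    by (intro sum.cong) (auto simp: T)
  also have "\<dots> = (of_nat q - 1) / 2 *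
      ((if p dvd n then of_nat q else of_nat (p ^ e)) * E (of_nat (p ^ e))
       + (if p dvd n then of_nat q else - of_nat (p ^ e)) * E (- of_nat (p ^ e)))"
    using sum_over_gauss_sums[of "\<lambda>r. (if p dvd n then of_nat q else r) * E r"] .
  also have "E (of_nat (p ^ e)) = of_nat (alpha p e n)"
    by (simp add: E_def)
  also have "E (- of_nat (p ^ e)) = (-1) ^ n * of_int (beta p e n)"
    using neg by (simp only: E_def if_False)
  also have "(if p dvd n then of_nat q else of_nat (p ^ e)) * of_nat (alpha p e n)
       + (if p dvd n then of_nat q else - of_nat (p ^ e)) * ((-1) ^ n * of_int (beta p e n))
     = (if p dvd n then of_nat q * (of_nat (alpha p e n) + (-1) ^ n * of_int (beta p e n))
        else of_nat (p ^ e) * (of_nat (alpha p e n) - (-1) ^ n * of_int (beta p e n) :: complex))"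
    by (simp add: distrib_left right_diff_distrib)
  finally show ?thesis
    unfolding T0 .
qed

end

theorem theorem4p1:
  fixes p e q n :: nat
  assumes "prime p" and "odd p" and "e \<ge> 1" and "q = p ^ (2 * e)"
    and "CARD('a :: {field, finite}) = q"
    and "n \<ge> 1"
  shows "(\<not> p dvd n \<longrightarrow>
            real (M n (0 :: 'a) 0) =
              1 / real q ^ 2 * real (q choose n)
              + (real q - 1) / (2 * sqrt (real q ^ 3))
                * (real (alpha p e n) - (- 1) ^ n * real_of_int (beta p e n)))
         \<and> (p dvd n \<longrightarrow>
            real (M n (0 :: 'a) 0) =
              1 / real q ^ 2 * real (q choose n)
              + (real q - 1) / real q ^ 2 * real ((q div p) choose (n div p))
              + (real q - 1) / (2 * real q)
                * (real (alpha p e n) + (- 1) ^ n * real_of_int (beta p e n)))"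
proof -
  have card: "CARD('a) = p ^ (2 * e)"
    using assms by simp
  have "2 * e \<ge> 1"
    using assms by simp
  then obtain \<psi> :: "'a \<Rightarrow> complex" where
    "\<And>x y. \<psi> (x + y) = \<psi> x * \<psi> y" "\<And>x. norm (\<psi> x) = 1" "\<exists>x. \<psi> x \<noteq> 1"
    using nontrivial_additive_character_exists[OF assms(1) card] by blast
  then interpret finite_field_character \<psi> p e q
    using assms by unfold_locales auto
  let ?count = "real (q choose n)
     + (if p dvd n then (real q - 1) * real (q div p choose (n div p)) else 0)
     + (real q - 1) / 2 *
         (if p dvd n then real q * (real (alpha p e n) + (-1) ^ n * real_of_int (beta p e n))
          else real (p ^ e) * (real (alpha p e n) - (-1) ^ n * real_of_int (beta p e n)))"
  have "complex_of_real (real q ^ 2 * real (M n (0 :: 'a) 0)) = complex_of_real ?count"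
    using count_formula[of n] by (simp split: if_splits)
  hence count: "real q ^ 2 * real (M n (0 :: 'a) 0) = ?count"
    by (simp only: of_real_eq_iff)
  define r where "r = real (p ^ e)"
  have "r > 0"
    using prime_gt_0_nat[OF assms(1)] by (simp add: r_def)
  have q: "real q = r ^ 2"
    unfolding r_def assms(4) by (simp flip: power_mult add: mult.commute)
  \<comment> \<open>With \<open>r = p ^ e\<close> and \<open>q = r ^ 2\<close>, the coefficient
    \<open>r / (2 * q ^ 2)\<close> becomes \<open>1 / (2 * r ^ 3)\<close>, matching the square root
    in case (i).\<close>
  have sqrt: "sqrt (real q ^ 3) = r ^ 3"
    by (rule real_sqrt_unique) (use \<open>r > 0\<close> in \<open>simp_all add: q flip: power_mult\<close>)
  have "real (M n (0 :: 'a) 0) = ?count / (r ^ 2) ^ 2"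
    using count \<open>r > 0\<close> by (simp add: q field_simps)
  thus ?thesis
    unfolding sqrt unfolding q r_def[symmetric] using \<open>r > 0\<close>
    by (simp add: add_divide_distrib power2_eq_square power3_eq_cube)
qed

end
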